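(* Let $D:H(\mathbb{C})\to H(\mathbb{C})$ be the differentiation operator. For every non-constant polynomial $P$, the operator $P(D)$ possesses a hypercyclic subspace.
   Context: $H(\mathbb{C})$ is the Fréchet space of entire functions with the topology of uniform convergence on compact sets; $Df=f'$. A vector $f$ is hypercyclic for a continuous linear operator $T$ on $H(\mathbb{C})$ if $\{T^nf:n\ge 1\}$ is dense in $H(\mathbb{C})$. A hypercyclic subspace for $T$ is an infinite-dimensional closed linear subspace of $H(\mathbb{C})$ in which every non-zero vector is hypercyclic for $T$. *)

theory Defs
  imports
    "HOL-Complex_Analysis.Complex_Analysis"
    "HOL-Computational_Algebra.Polynomial"
    "HOL-Library.Function_Algebras"
begin

definition entire_functions :: "(complex \<Rightarrow> complex) set" where
  "entire_functions = {f. f holomorphic_on UNIV}"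

text \<open>
  The topology of uniform convergence on compact sets: the sets
  \<open>{g. g entire and dist (f z) (g z) < e for all z in K}\<close>, for compact \<open>K\<close> and \<open>e > 0\<close>, form a
  neighbourhood base at \<open>f\<close>.
\<close>

definition compact_nhd :: "(complex \<Rightarrow> complex) \<Rightarrow> complex set \<Rightarrow> real \<Rightarrow> (complex \<Rightarrow> complex) set" where
  "compact_nhd f K e = {g \<in> entire_functions. \<forall>z\<in>K. dist (f z) (g z) < e}"

definition entire_topology :: "(complex \<Rightarrow> complex) topology" where
  "entire_topology = topology (\<lambda>U. U \<subseteq> entire_functions \<and>
     (\<forall>f\<in>U. \<exists>K e. compact K \<and> e > 0 \<and> compact_nhd f K e \<subseteq> U))"

lemma openin_entire_topology:
  "openin entire_topology U \<longleftrightarrow> U \<subseteq> entire_functions \<and>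
     (\<forall>f\<in>U. \<exists>K e. compact K \<and> e > 0 \<and> compact_nhd f K e \<subseteq> U)"
proof -
  have "istopology (\<lambda>U. U \<subseteq> entire_functions \<and>
     (\<forall>f\<in>U. \<exists>K e. compact K \<and> e > 0 \<and> compact_nhd f K e \<subseteq> U))" (is "istopology ?P")
    unfolding istopology_def
  proof (intro conjI allI impI)
    fix S T assume S: "?P S" and T: "?P T"
    show "S \<inter> T \<subseteq> entire_functions" using S by auto
    show "\<forall>f\<in>S \<inter> T. \<exists>K e. compact K \<and> e > 0 \<and> compact_nhd f K e \<subseteq> S \<inter> T"
    proof
      fix f assume f: "f \<in> S \<inter> T"
      obtain K e where K: "compact K" "e > 0" "compact_nhd f K e \<subseteq> S" using S f by blast
      obtain K' e' where K': "compact K'" "e' > 0" "compact_nhd f K' e' \<subseteq> T" using T f by blast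
      have "compact_nhd f (K \<union> K') (min e e') \<subseteq> S \<inter> T"
        using K(3) K'(3) unfolding compact_nhd_def by auto
      then show "\<exists>K e. compact K \<and> e > 0 \<and> compact_nhd f K e \<subseteq> S \<inter> T"
        using K K' by (intro exI[of _ "K \<union> K'"] exI[of _ "min e e'"]) auto
    qed
  next
    fix \<K> assume H: "\<forall>S\<in>\<K>. ?P S"
    show "\<Union>\<K> \<subseteq> entire_functions" using H by blast
    show "\<forall>f\<in>\<Union>\<K>. \<exists>K e. compact K \<and> e > 0 \<and> compact_nhd f K e \<subseteq> \<Union>\<K>"
      using H by (meson Sup_upper UnionE subset_trans)
  qed
  then show ?thesis
    unfolding entire_topology_def by (simp add: topology_inverse')
qed

lemma topspace_entire_topology: "topspace entire_topology = entire_functions"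
proof -
  have "openin entire_topology entire_functions"
    unfolding openin_entire_topology compact_nhd_def
    by (auto intro!: exI[of _ "{}"] exI[of _ "1::real"])
  moreover have "topspace entire_topology \<subseteq> entire_functions"
    using openin_entire_topology openin_topspace by blast
  ultimately show ?thesis
    using openin_subset by blast
qed

lemma openin_compact_nhd:
  assumes "f \<in> entire_functions" "compact K"
  shows "openin entire_topology (compact_nhd f K e)"
proof (cases "K = {}")
  case True
  then show ?thesis
    using openin_topspace[of entire_topology]
    by (simp add: compact_nhd_def topspace_entire_topology)
next
  case False
  show ?thesis
    unfolding openin_entire_topology
  proof (intro conjI ballI)
    show "compact_nhd f K e \<subseteq> entire_functions" by (auto simp: compact_nhd_def)
    fix g assume g: "g \<in> compact_nhd f K e"
    have "continuous_on K f" "continuous_on K g"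
      using g assms(1) unfolding compact_nhd_def entire_functions_def
      by (auto intro: holomorphic_on_imp_continuous_on holomorphic_on_subset)
    then have "continuous_on K (\<lambda>z. dist (f z) (g z))"
      by (intro continuous_intros)
    then obtain w where w: "w \<in> K" "\<forall>z\<in>K. dist (f z) (g z) \<le> dist (f w) (g w)"
      using continuous_attains_sup[OF assms(2) False] by blast
    define d where "d = e - dist (f w) (g w)"
    have "d > 0" using g w(1) by (auto simp: d_def compact_nhd_def)
    moreover have "compact_nhd g K d \<subseteq> compact_nhd f K e"
    proof
      fix h assume h: "h \<in> compact_nhd g K d"
      have "dist (f z) (h z) < e" if "z \<in> K" for z
      proof -
        have "dist (g z) (h z) < d" using h that by (auto simp: compact_nhd_def)
        then show ?thesis
          using dist_triangle[of "f z" "h z" "g z"] w(2) that unfolding d_def by fastforce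
      qed
      then show "h \<in> compact_nhd f K e" using h by (auto simp: compact_nhd_def)
    qed
    ultimately show "\<exists>K' e'. compact K' \<and> e' > 0 \<and> compact_nhd g K' e' \<subseteq> compact_nhd f K e"
      using assms(2) by blast
  qed
qed

definition cscale :: "complex \<Rightarrow> (complex \<Rightarrow> complex) \<Rightarrow> (complex \<Rightarrow> complex)" where
  "cscale c f = (\<lambda>z. c * f z)"

global_interpretation cfun: vector_space cscale
  by unfold_locales (auto simp: cscale_def algebra_simps fun_eq_iff)

lemma subspace_entire_functions: "cfun.subspace entire_functions"
  unfolding cfun.subspace_def entire_functions_def cscale_def zero_fun_def plus_fun_def
  by (auto intro!: holomorphic_intros)

definition hypercyclic_vector ::
    "((complex \<Rightarrow> complex) \<Rightarrow> (complex \<Rightarrow> complex)) \<Rightarrow> (complex \<Rightarrow> complex) \<Rightarrow> bool" where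
  "hypercyclic_vector T f \<longleftrightarrow> f \<in> entire_functions \<and>
     entire_topology closure_of {(T ^^ n) f | n. n \<ge> 1} = entire_functions"

text \<open>
  Infinite-dimensionality is stated through finite spanning sets, because \<open>cfun.dim\<close> returns a
  junk value on infinite-dimensional subspaces.
\<close>

definition hypercyclic_subspace ::
    "((complex \<Rightarrow> complex) \<Rightarrow> (complex \<Rightarrow> complex)) \<Rightarrow> (complex \<Rightarrow> complex) set \<Rightarrow> bool" where
  "hypercyclic_subspace T M \<longleftrightarrow>
     cfun.subspace M \<and> closedin entire_topology M \<and>
     \<not> (\<exists>B. finite B \<and> cfun.span B = M) \<and>
     (\<forall>f\<in>M. f \<noteq> 0 \<longrightarrow> hypercyclic_vector T f)"

definition poly_op ::
    "complex poly \<Rightarrow> ((complex \<Rightarrow> complex) \<Rightarrow> (complex \<Rightarrow> complex)) \<Rightarrow>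
     (complex \<Rightarrow> complex) \<Rightarrow> (complex \<Rightarrow> complex)" where
  "poly_op P T f = (\<Sum>i\<le>degree P. cscale (coeff P i) ((T ^^ i) f))"

text \<open>\<open>poly_op P deriv\<close> restricts to a continuous linear operator on the entire functions.\<close>

lemma poly_op_deriv_apply:
  "poly_op P deriv f z = (\<Sum>i\<le>degree P. coeff P i * (deriv ^^ i) f z)"
proof -
  have "(\<Sum>i\<in>A. F i) z = (\<Sum>i\<in>A. F i z)" if "finite A" for A and F :: "nat \<Rightarrow> complex \<Rightarrow> complex"
    using that by induction auto
  then show ?thesis by (simp add: poly_op_def cscale_def)
qed

lemma poly_op_deriv_entire:
  assumes "f \<in> entire_functions" shows "poly_op P deriv f \<in> entire_functions"
proof -
  have "(\<lambda>z. \<Sum>i\<le>degree P. coeff P i * (deriv ^^ i) f z) holomorphic_on UNIV"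
    using assms unfolding entire_functions_def
    by (intro holomorphic_intros) auto
  moreover have "poly_op P deriv f = (\<lambda>z. \<Sum>i\<le>degree P. coeff P i * (deriv ^^ i) f z)"
    by (rule ext) (rule poly_op_deriv_apply)
  ultimately show ?thesis by (simp add: entire_functions_def)
qed

lemma poly_op_deriv_linear:
  assumes "f \<in> entire_functions" "g \<in> entire_functions"
  shows "poly_op P deriv (f + g) = poly_op P deriv f + poly_op P deriv g"
    and "poly_op P deriv (cscale c f) = cscale c (poly_op P deriv f)"
proof -
  have f: "f holomorphic_on UNIV" and g: "g holomorphic_on UNIV"
    using assms by (auto simp: entire_functions_def)
  have *: "(deriv ^^ i) (f + g) z = (deriv ^^ i) f z + (deriv ^^ i) g z" for i z
    using higher_deriv_add[OF f g] by (simp add: plus_fun_def)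
  show "poly_op P deriv (f + g) = poly_op P deriv f + poly_op P deriv g"
    by (rule ext) (simp add: poly_op_deriv_apply * algebra_simps sum.distrib)
  have **: "(deriv ^^ i) (\<lambda>w. c * f w) z = c * (deriv ^^ i) f z" for i z
    using higher_deriv_cmult[OF f] by simp
  show "poly_op P deriv (cscale c f) = cscale c (poly_op P deriv f)"
    by (rule ext) (simp add: poly_op_deriv_apply ** cscale_def algebra_simps sum_distrib_left)
qed

lemma poly_op_deriv_continuous:
  "continuous_map entire_topology entire_topology (poly_op P deriv)"
proof -
  let ?L = "poly_op P deriv"
  have "openin entire_topology {f \<in> entire_functions. ?L f \<in> U}" if U: "openin entire_topology U" for U
    unfolding openin_entire_topology
  proof (intro conjI ballI)
    fix f assume "f \<in> {f \<in> entire_functions. ?L f \<in> U}"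
    then have f: "f \<in> entire_functions" "?L f \<in> U" by auto
    obtain K e where K: "compact K" "e > 0" "compact_nhd (?L f) K e \<subseteq> U"
      using U f(2) unfolding openin_entire_topology by blast
    define C where "C = (\<Sum>i\<le>degree P. norm (coeff P i) * fact i)"
    have C: "C \<ge> 0" unfolding C_def by (intro sum_nonneg) auto
    define d where "d = e / (1 + C)"
    have d: "d > 0" using K C by (simp add: d_def)
    define K' where "K' = {x + y |x y. x \<in> K \<and> y \<in> cball (0::complex) 1}"
    have K': "compact K'" unfolding K'_def using K(1) by (intro compact_sums) auto
    have "compact_nhd f K' d \<subseteq> {f \<in> entire_functions. ?L f \<in> U}"
    proof
      fix g assume "g \<in> compact_nhd f K' d"
      then have g: "g \<in> entire_functions" and fg: "\<And>z. z \<in> K' \<Longrightarrow> dist (f z) (g z) < d"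
        by (auto simp: compact_nhd_def)
      have hf: "f holomorphic_on UNIV" and hg: "g holomorphic_on UNIV"
        using f g by (auto simp: entire_functions_def)
      have "dist (?L f z) (?L g z) < e" if z: "z \<in> K" for z
      proof -
        have b: "norm ((deriv ^^ i) f z - (deriv ^^ i) g z) \<le> fact i * d" for i
        proof -
          have "norm ((deriv ^^ i) (\<lambda>w. f w - g w) z) \<le> fact i * d / 1 ^ i"
          proof (rule Cauchy_inequality)
            show "(\<lambda>w. f w - g w) holomorphic_on ball z 1"
              using hf hg by (intro holomorphic_intros) (auto intro: holomorphic_on_subset)
            show "continuous_on (cball z 1) (\<lambda>w. f w - g w)"
              using hf hg by (intro continuous_intros)
                (auto intro: holomorphic_on_imp_continuous_on holomorphic_on_subset)
            show "norm (f w - g w) \<le> d" if "norm (z - w) = 1" for w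
            proof -
              have "w = z + (w - z)" "w - z \<in> cball 0 1" using that by (auto simp: norm_minus_commute)
              then have "w \<in> K'" unfolding K'_def using z by blast
              then show ?thesis using fg[of w] by (simp add: dist_norm)
            qed
          qed simp
          then show ?thesis using higher_deriv_diff[OF hf hg] by simp
        qed
        have "dist (?L f z) (?L g z) =
            norm (\<Sum>i\<le>degree P. coeff P i * ((deriv ^^ i) f z - (deriv ^^ i) g z))"
          by (simp add: poly_op_deriv_apply dist_norm sum_subtractf right_diff_distrib)
        also have "\<dots> \<le> (\<Sum>i\<le>degree P. norm (coeff P i) * (fact i * d))"
          by (rule sum_norm_le) (simp only: norm_mult mult_left_mono b norm_ge_zero)
        also have "\<dots> = C * d" by (simp add: C_def sum_distrib_right mult.assoc)
        also have "\<dots> < (1 + C) * d" using d by (simp add: algebra_simps)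
        also have "\<dots> = e" using C by (simp add: d_def)
        finally show ?thesis .
      qed
      then have "?L g \<in> compact_nhd (?L f) K e"
        using poly_op_deriv_entire[OF g] by (simp add: compact_nhd_def)
      then show "g \<in> {f \<in> entire_functions. ?L f \<in> U}" using K g by auto
    qed
    then show "\<exists>K e. compact K \<and> e > 0 \<and> compact_nhd f K e \<subseteq> {f \<in> entire_functions. ?L f \<in> U}"
      using K' d by blast
  qed auto
  then show ?thesis
    by (auto simp: continuous_map_def topspace_entire_topology poly_op_deriv_entire)
qed

end

(* Conjugation by exp (alpha z), where alpha is a root of P, turns P(D) into Q(D) with Q = x^k R,
   k >= 1 and R(0) ~= 0. On Taylor coefficients D is the backward shift, so Q(D)^n kills z^p for
   p < k n, and every polynomial q is the image under Q(D)^n of a polynomial supported on exponents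
   in [k n, k n + deg q], which is tiny for large n. Choose m_0 < k n_0 << m_1 < k n_1 << ... and
   attach to every z^(m_j) such tiny preimages y_i of q_i under Q(D)^(n_i) for infinitely many i,
   the q_i running through a dense set. A function f in the resulting subspace is determined by its
   coefficients at the m_j; if the one at m_j is a ~= 0, then Q(D)^(n_i) f = a q_i + Q(D)^(n_i) t
   for the i attached to j, where t is the tail of f beyond m_(i+1). The second summand tends to 0,
   since m_(i+1) is so large that its growth is absorbed by replacing the radius r by 4 r. The
   subspace is closed because it is cut out by linear equations between Taylor coefficients. *)

theory Submission
  imports
    Defs
    "HOL-Computational_Algebra.Computational_Algebra"
    "HOL-Computational_Algebra.Field_as_Ring"
begin

section \<open>Polynomials acting on sequences by the backward shift\<close>

definition act :: "complex poly \<Rightarrow> (nat \<Rightarrow> complex) \<Rightarrow> nat \<Rightarrow> complex" where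
  "act p b n = (\<Sum>j\<le>degree p. coeff p j * b (n + j))"

lemma act_altdef:
  assumes "degree p \<le> d"
  shows "act p b n = (\<Sum>j\<le>d. coeff p j * b (n + j))"
  unfolding act_def using assms
  by (intro sum.mono_neutral_left) (auto simp: coeff_eq_0)

lemma act_0 [simp]: "act 0 b n = 0"
  by (simp add: act_def)

lemma act_pCons: "act (pCons a p) b n = a * b n + act p b (Suc n)"
proof -
  have "act (pCons a p) b n = (\<Sum>j\<le>Suc (degree p). coeff (pCons a p) j * b (n + j))"
    by (rule act_altdef) (simp add: degree_pCons_le)
  also have "\<dots> = a * b n + act p b (Suc n)"
    by (subst sum.atMost_Suc_shift) (simp add: act_def)
  finally show ?thesis .
qed

lemma act_add: "act (p + q) b n = act p b n + act q b n"
proof -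
  let ?d = "max (degree p) (degree q)"
  have "act (p + q) b n = (\<Sum>j\<le>?d. coeff (p + q) j * b (n + j))"
    by (rule act_altdef) (rule degree_add_le_max)
  then show ?thesis
    by (simp add: act_altdef[of p ?d] act_altdef[of q ?d] algebra_simps sum.distrib)
qed

lemma act_smult: "act (smult c p) b n = c * act p b n"
  by (simp add: act_altdef[of _ "degree p"] sum_distrib_left mult.assoc)

text \<open>The shift makes sequences a module over the polynomials. Iterating an operator therefore
  amounts to taking powers of its polynomial.\<close>

lemma act_mult: "act (p * q) b n = act p (act q b) n"
proof (induction p arbitrary: n)
  case (pCons a p)
  then show ?case
    by (simp add: mult_pCons_left act_add act_smult act_pCons)
qed simp

text \<open>The entries before index \<open>k\<close> are never read: this is why a factor
  \<open>monom 1 k\<close> annihilates monomials of low degree.\<close>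

lemma act_monom_mult: "act (monom 1 k * p) b n = act p b (n + k)"
  by (induction k arbitrary: n) (simp_all add: monom_0 act_pCons monom_Suc)

lemma act_seq_add: "act p (\<lambda>s. a s + b s) n = act p a n + act p b n"
  by (simp add: act_def algebra_simps sum.distrib)

lemma act_seq_cmult: "act p (\<lambda>s. c * b s) n = c * act p b n"
  by (simp add: act_def algebra_simps sum_distrib_left)

section \<open>Seminorms on sequences of Taylor coefficients\<close>

text \<open>The numbers \<open>b p\<close> are thought of as derivatives at 0, so the power series
  meant has coefficients \<open>b p / fact p\<close>. With this scaling \<open>D\<close> is the
  plain backward shift, and \<open>seq_norm r\<close> dominates the series on the disc of radius
  \<open>r\<close>.\<close>

definition entire_seq :: "(nat \<Rightarrow> complex) \<Rightarrow> bool" where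
  "entire_seq b \<longleftrightarrow> (\<forall>r. summable (\<lambda>p. norm (b p) * r ^ p / fact p))"

definition seq_norm :: "real \<Rightarrow> (nat \<Rightarrow> complex) \<Rightarrow> real" where
  "seq_norm r b = (\<Sum>p. norm (b p) * r ^ p / fact p)"

lemma entire_seqD: "entire_seq b \<Longrightarrow> summable (\<lambda>p. norm (b p) * r ^ p / fact p)"
  by (simp add: entire_seq_def)

lemma entire_seqI:
  assumes "\<And>r. r \<ge> 1 \<Longrightarrow> summable (\<lambda>p. norm (b p) * r ^ p / fact p)"
  shows "entire_seq b"
  unfolding entire_seq_def
proof
  fix r :: real
  have "\<bar>r\<bar> ^ p \<le> (max 1 \<bar>r\<bar>) ^ p" for p by (intro power_mono) auto
  then show "summable (\<lambda>p. norm (b p) * r ^ p / fact p)"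
    by (intro summable_comparison_test[OF _ assms[of "max 1 \<bar>r\<bar>"]] exI[of _ 0])
       (auto simp: abs_mult power_abs intro!: divide_right_mono mult_left_mono)
qed

lemma entire_seq_bounded:
  assumes "entire_seq b" "\<And>p. norm (c p) \<le> norm (b p)"
  shows "entire_seq c"
  by (rule entire_seqI, rule summable_comparison_test[OF _ entire_seqD[OF assms(1)]])
     (auto intro!: exI[of _ 0] divide_right_mono mult_right_mono assms(2) simp: abs_mult)

lemma entire_seq_add:
  assumes "entire_seq b" "entire_seq c"
  shows "entire_seq (\<lambda>p. b p + c p)"
proof (rule entire_seqI)
  fix r :: real assume "r \<ge> 1"
  then show "summable (\<lambda>p. norm (b p + c p) * r ^ p / fact p)"
    by (intro summable_comparison_test[OF _ summable_add[OF entire_seqD[OF assms(1), of r] entire_seqD[OF assms(2), of r]]])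
       (auto intro!: exI[of _ 0] divide_right_mono mult_right_mono norm_triangle_ineq
         simp: abs_mult add_divide_distrib[symmetric] distrib_right[symmetric])
qed

lemma entire_seq_cmult:
  assumes "entire_seq b" shows "entire_seq (\<lambda>p. c * b p)"
  unfolding entire_seq_def
proof
  fix r :: real
  show "summable (\<lambda>p. norm (c * b p) * r ^ p / fact p)"
    using summable_mult[OF entire_seqD[OF assms, of r], of "norm c"]
    by (simp add: norm_mult mult.assoc)
qed

lemma seq_norm_nonneg: "r \<ge> 0 \<Longrightarrow> entire_seq b \<Longrightarrow> seq_norm r b \<ge> 0"
  unfolding seq_norm_def by (intro suminf_nonneg entire_seqD) auto

lemma seq_norm_triangle:
  assumes "entire_seq b" "entire_seq c" "r \<ge> 0"
  shows "seq_norm r (\<lambda>p. b p + c p) \<le> seq_norm r b + seq_norm r c"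
proof -
  have "seq_norm r (\<lambda>p. b p + c p) \<le> (\<Sum>p. norm (b p) * r ^ p / fact p + norm (c p) * r ^ p / fact p)"
    unfolding seq_norm_def using assms
    by (intro suminf_le entire_seqD entire_seq_add summable_add)
       (auto intro!: divide_right_mono mult_right_mono norm_triangle_ineq
         simp: add_divide_distrib[symmetric] distrib_right[symmetric])
  then show ?thesis
    unfolding seq_norm_def using assms by (simp add: suminf_add entire_seqD)
qed

lemma seq_norm_cmult: "entire_seq b \<Longrightarrow> seq_norm r (\<lambda>p. c * b p) = norm c * seq_norm r b"
  unfolding seq_norm_def
  by (subst suminf_mult[symmetric]) (auto simp: entire_seqD norm_mult mult.assoc)

text \<open>Since \<open>(p + j) choose j\<close> is at most \<open>2 ^ (p + j)\<close>,
  \<open>1 / fact p\<close> is at most \<open>fact j * 2 ^ (p + j) / fact (p + j)\<close>. The power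
  of 2 goes into the radius, and \<open>r \<ge> 1\<close> supplies the missing
  \<open>r ^ j\<close>.\<close>

lemma shift_bound:
  fixes r x :: real
  assumes "r \<ge> 1" "x \<ge> 0"
  shows "x * r ^ p / fact p \<le> fact j * (x * (2 * r) ^ (p + j) / fact (p + j))"
proof -
  have "(p + j) choose j \<le> 2 ^ (p + j)" by (rule binomial_le_pow2)
  then have 1: "real ((p + j) choose j) \<le> 2 ^ (p + j)"
    by (metis of_nat_le_iff of_nat_numeral of_nat_power)
  have 2: "real ((p + j) choose j) = fact (p + j) / (fact j * fact p)"
    by (simp add: binomial_fact)
  have "1 / fact p \<le> (fact j * 2 ^ (p + j) / fact (p + j) :: real)"
    using 1 unfolding 2 by (simp add: field_simps)
  moreover have "r ^ p \<le> r ^ (p + j)" using assms by (intro power_increasing) auto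
  ultimately have "x * (r ^ p * (1 / fact p)) \<le> x * (r ^ (p + j) * (fact j * 2 ^ (p + j) / fact (p + j)))"
    using assms by (intro mult_left_mono mult_mono) auto
  then show ?thesis by (simp add: power_mult_distrib mult_ac)
qed

lemma
  assumes "entire_seq b" "r \<ge> 1"
  shows summable_shift: "summable (\<lambda>p. norm (b (p + j)) * r ^ p / fact p)"
    and suminf_shift_le: "(\<Sum>p. norm (b (p + j)) * r ^ p / fact p) \<le> fact j * seq_norm (2 * r) b"
proof -
  let ?f = "\<lambda>p. norm (b p) * (2 * r) ^ p / fact p"
  have s: "summable (\<lambda>p. ?f (p + j))"
    using entire_seqD[OF assms(1)] by (subst summable_iff_shift) blast
  have le: "norm (b (p + j)) * r ^ p / fact p \<le> fact j * ?f (p + j)" for p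
    using shift_bound[of r "norm (b (p + j))" p j] assms(2) by simp
  show 1: "summable (\<lambda>p. norm (b (p + j)) * r ^ p / fact p)"
    using assms(2) le
    by (intro summable_comparison_test[OF _ summable_mult[OF s, of "fact j"]] exI[of _ 0]) (auto simp: abs_mult)
  have "(\<Sum>p. norm (b (p + j)) * r ^ p / fact p) \<le> (\<Sum>p. fact j * ?f (p + j))"
    by (intro suminf_le 1 le summable_mult s)
  also have "\<dots> = fact j * (\<Sum>p. ?f (p + j))" by (rule suminf_mult[OF s])
  also have "(\<Sum>p. ?f (p + j)) \<le> seq_norm (2 * r) b"
    unfolding seq_norm_def using assms(2)
    by (subst suminf_split_initial_segment[OF entire_seqD[OF assms(1)], of _ j]) (auto intro!: sum_nonneg)
  finally show "(\<Sum>p. norm (b (p + j)) * r ^ p / fact p) \<le> fact j * seq_norm (2 * r) b"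
    by simp
qed

text \<open>A shift by \<open>j\<close> costs \<open>fact j\<close> and a doubling of the radius,
  whatever \<open>j\<close> is. So one constant, independent of \<open>r\<close>, serves for the
  passage from radius \<open>2 * r\<close> to \<open>r\<close>.\<close>

definition act_const :: "complex poly \<Rightarrow> real" where
  "act_const p = (\<Sum>j\<le>degree p. norm (coeff p j) * fact j)"

lemma
  assumes "entire_seq b"
  shows entire_seq_act: "entire_seq (act p b)"
    and seq_norm_act: "r \<ge> 1 \<Longrightarrow> seq_norm r (act p b) \<le> act_const p * seq_norm (2 * r) b"
proof -
  have *: "summable (\<lambda>n. norm (act p b n) * r ^ n / fact n) \<and>
      seq_norm r (act p b) \<le> act_const p * seq_norm (2 * r) b" if r: "r \<ge> 1" for r
  proof -
    let ?g = "\<lambda>n. \<Sum>j\<le>degree p. norm (coeff p j) * (norm (b (n + j)) * r ^ n / fact n)"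
    have s: "summable ?g"
      by (intro summable_sum summable_mult summable_shift assms r)
    have le: "norm (act p b n) * r ^ n / fact n \<le> ?g n" for n
    proof -
      have "norm (act p b n) \<le> (\<Sum>j\<le>degree p. norm (coeff p j) * norm (b (n + j)))"
        unfolding act_def by (rule sum_norm_le) (simp add: norm_mult)
      then have "norm (act p b n) * (r ^ n / fact n) \<le> (\<Sum>j\<le>degree p. norm (coeff p j) * norm (b (n + j))) * (r ^ n / fact n)"
        using r by (intro mult_right_mono) auto
      then show ?thesis by (simp add: sum_distrib_right sum_divide_distrib mult.assoc)
    qed
    have 1: "summable (\<lambda>n. norm (act p b n) * r ^ n / fact n)"
      using le r by (intro summable_comparison_test[OF _ s] exI[of _ 0]) (auto simp: abs_mult)
    have "seq_norm r (act p b) \<le> (\<Sum>n. ?g n)"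
      unfolding seq_norm_def by (intro suminf_le le 1 s)
    also have "\<dots> = (\<Sum>j\<le>degree p. norm (coeff p j) * (\<Sum>n. norm (b (n + j)) * r ^ n / fact n))"
      using summable_shift[OF assms r]
      by (subst suminf_sum) (auto intro!: summable_mult sum.cong suminf_mult simp del: times_divide_eq_right)
    also have "\<dots> \<le> (\<Sum>j\<le>degree p. norm (coeff p j) * (fact j * seq_norm (2 * r) b))"
      by (intro sum_mono mult_left_mono suminf_shift_le assms r) auto
    also have "\<dots> = act_const p * seq_norm (2 * r) b"
      by (simp add: act_const_def sum_distrib_right mult.assoc)
    finally show ?thesis using 1 by simp
  qed
  show "entire_seq (act p b)" using * by (intro entire_seqI) blast
  show "r \<ge> 1 \<Longrightarrow> seq_norm r (act p b) \<le> act_const p * seq_norm (2 * r) b" using * by blast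
qed

definition seq_tail :: "nat \<Rightarrow> (nat \<Rightarrow> complex) \<Rightarrow> nat \<Rightarrow> complex" where
  "seq_tail m b p = (if p < m then 0 else b p)"

lemma entire_seq_tail: "entire_seq b \<Longrightarrow> entire_seq (seq_tail m b)"
  by (erule entire_seq_bounded) (simp add: seq_tail_def)

text \<open>Doubling the radius multiplies the term of index \<open>p\<close> by
  \<open>2 ^ p\<close>, which is at least \<open>2 ^ m\<close> on the support of the tail. A large
  constant can thus be paid for by starting the tail late.\<close>

lemma seq_norm_tail_le:
  assumes "entire_seq b" "r \<ge> 0"
  shows "2 ^ m * seq_norm r (seq_tail m b) \<le> seq_norm (2 * r) (seq_tail m b)"
proof -
  have "2 ^ m * seq_norm r (seq_tail m b) = (\<Sum>p. 2 ^ m * (norm (seq_tail m b p) * r ^ p / fact p))"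
    unfolding seq_norm_def by (rule suminf_mult[symmetric]) (intro entire_seqD entire_seq_tail assms)
  also have "\<dots> \<le> seq_norm (2 * r) (seq_tail m b)"
    unfolding seq_norm_def
  proof (intro suminf_le summable_mult entire_seqD entire_seq_tail assms)
    fix p
    show "2 ^ m * (norm (seq_tail m b p) * r ^ p / fact p) \<le> norm (seq_tail m b p) * (2 * r) ^ p / fact p"
    proof (cases "p < m")
      case False
      then have "(2::real) ^ m \<le> 2 ^ p" by (intro power_increasing) auto
      then have "2 ^ m * (norm (seq_tail m b p) * r ^ p / fact p) \<le> 2 ^ p * (norm (seq_tail m b p) * r ^ p / fact p)"
        using assms(2) by (intro mult_right_mono) auto
      then show ?thesis by (simp add: power_mult_distrib mult_ac)
    qed (simp add: seq_tail_def)
  qed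
  finally show ?thesis .
qed

lemma seq_norm_tail_small:
  assumes "entire_seq b" "r \<ge> 0" "e > 0"
  shows "\<exists>M. \<forall>m\<ge>M. seq_norm r (seq_tail m b) < e"
proof -
  let ?f = "\<lambda>p. norm (b p) * r ^ p / fact p"
  obtain M where M: "\<And>m. m \<ge> M \<Longrightarrow> norm (\<Sum>i. ?f (i + m)) < e"
    using suminf_exist_split[OF assms(3) entire_seqD[OF assms(1)], of r] by blast
  have "seq_norm r (seq_tail m b) = (\<Sum>i. ?f (i + m))" for m
    unfolding seq_norm_def
    by (subst suminf_split_initial_segment[OF entire_seqD[OF entire_seq_tail[OF assms(1)]], of _ _ m])
       (simp add: seq_tail_def)
  with M show ?thesis by (metis abs_ge_self order_le_less_trans real_norm_def)
qed

section \<open>Twisted Taylor coefficients\<close>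

text \<open>Twisting by \<open>exp (- \<alpha> z)\<close> turns \<open>D - \<alpha>\<close> into \<open>D\<close>, and \<open>D\<close> is the backward shift on the
  numbers \<open>f\<^sup>(\<^sup>p\<^sup>)(0)\<close>.\<close>

definition twisted_coeff :: "complex \<Rightarrow> (complex \<Rightarrow> complex) \<Rightarrow> nat \<Rightarrow> complex" where
  "twisted_coeff \<alpha> f p = (deriv ^^ p) (\<lambda>z. exp (- \<alpha> * z) * f z) 0"

lemma entire_twist: "f \<in> entire_functions \<Longrightarrow> (\<lambda>z. exp (c * z) * f z) holomorphic_on UNIV"
  by (auto simp: entire_functions_def intro!: holomorphic_intros)

lemma entire_deriv: "f \<in> entire_functions \<Longrightarrow> deriv f \<in> entire_functions"
  by (auto simp: entire_functions_def intro!: holomorphic_intros)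

lemma twisted_coeff_add:
  assumes "f \<in> entire_functions" "g \<in> entire_functions"
  shows "twisted_coeff \<alpha> (f + g) p = twisted_coeff \<alpha> f p + twisted_coeff \<alpha> g p"
  using higher_deriv_add[OF entire_twist[OF assms(1), of "- \<alpha>"]
      entire_twist[OF assms(2), of "- \<alpha>"], of 0 p]
  by (simp add: twisted_coeff_def distrib_left)

lemma twisted_coeff_cscale:
  assumes "f \<in> entire_functions"
  shows "twisted_coeff \<alpha> (cscale c f) p = c * twisted_coeff \<alpha> f p"
  using higher_deriv_cmult[OF entire_twist[OF assms, of "- \<alpha>"], of 0 p c]
  by (simp add: twisted_coeff_def cscale_def mult.left_commute)

lemma twisted_coeff_zero: "twisted_coeff \<alpha> 0 p = 0"
  by (simp add: twisted_coeff_def)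

lemma twisted_coeff_diff:
  assumes "f \<in> entire_functions" "g \<in> entire_functions"
  shows "twisted_coeff \<alpha> (f - g) p = twisted_coeff \<alpha> f p - twisted_coeff \<alpha> g p"
  using higher_deriv_diff[OF entire_twist[OF assms(1), of "- \<alpha>"]
      entire_twist[OF assms(2), of "- \<alpha>"], of 0 p]
  by (simp add: twisted_coeff_def right_diff_distrib)

text \<open>The product rule for \<open>exp (- \<alpha> * z) * f z\<close>, solved for the term with
  \<open>deriv f\<close>: under the twist, \<open>D\<close> becomes \<open>\<alpha>\<close> plus the
  shift.\<close>

lemma twisted_coeff_deriv:
  assumes "f \<in> entire_functions"
  shows "twisted_coeff \<alpha> (deriv f) p = \<alpha> * twisted_coeff \<alpha> f p + twisted_coeff \<alpha> f (Suc p)"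
proof -
  let ?g = "\<lambda>z. exp (- \<alpha> * z) * f z"
  have f: "f holomorphic_on UNIV" using assms by (simp add: entire_functions_def)
  have "(f has_field_derivative deriv f z) (at z)" for z
    using f holomorphic_derivI by blast
  then have "(?g has_field_derivative (exp (- \<alpha> * z) * deriv f z - \<alpha> * ?g z)) (at z)" for z
    by (auto intro!: derivative_eq_intros)
  then have "deriv ?g = (\<lambda>z. exp (- \<alpha> * z) * deriv f z - \<alpha> * ?g z)"
    by (intro ext DERIV_imp_deriv)
  then have "twisted_coeff \<alpha> f (Suc p) = (deriv ^^ p) (\<lambda>z. exp (- \<alpha> * z) * deriv f z - \<alpha> * ?g z) 0"
    unfolding twisted_coeff_def funpow_Suc_right by simp
  also have "\<dots> = twisted_coeff \<alpha> (deriv f) p - (deriv ^^ p) (\<lambda>z. \<alpha> * ?g z) 0"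
    unfolding twisted_coeff_def
    by (rule higher_deriv_diff[OF entire_twist[OF entire_deriv[OF assms]]])
       (use entire_twist[OF assms, of "- \<alpha>"] in \<open>auto intro: holomorphic_on_mult\<close>)
  also have "(deriv ^^ p) (\<lambda>z. \<alpha> * ?g z) 0 = \<alpha> * twisted_coeff \<alpha> f p"
    unfolding twisted_coeff_def by (rule higher_deriv_cmult[OF entire_twist[OF assms]]) auto
  finally show ?thesis by simp
qed

section \<open>Differential operators in twisted coefficients\<close>

lemma poly_op_pCons: "poly_op (pCons a p) deriv f = cscale a f + poly_op p deriv (deriv f)"
proof
  fix z
  have "poly_op (pCons a p) deriv f z = (\<Sum>i\<le>Suc (degree p). coeff (pCons a p) i * (deriv ^^ i) f z)"
    unfolding poly_op_deriv_apply
    by (intro sum.mono_neutral_left) (auto simp: coeff_eq_0 degree_pCons_le)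
  also have "\<dots> = a * f z + poly_op p deriv (deriv f) z"
    by (subst sum.atMost_Suc_shift) (simp add: poly_op_deriv_apply funpow_Suc_right del: funpow.simps)
  finally show "poly_op (pCons a p) deriv f z = (cscale a f + poly_op p deriv (deriv f)) z"
    by (simp add: cscale_def)
qed

lemma poly_op_zero: "poly_op 0 deriv f = 0"
  by (rule ext) (simp add: poly_op_deriv_apply)

text \<open>Under the twist \<open>deriv\<close> becomes the action of
  \<open>[:\<alpha>, 1:]\<close>, so this linear polynomial is substituted into \<open>p\<close>.
  The induction peels off the constant coefficient and passes from \<open>f\<close> to its
  derivative, hence the generalisation over \<open>f\<close>.\<close>

lemma twisted_coeff_poly_op:
  assumes "f \<in> entire_functions"
  shows "twisted_coeff \<alpha> (poly_op p deriv f) n = act (pcompose p [:\<alpha>, 1:]) (twisted_coeff \<alpha> f) n"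
  using assms
proof (induction p arbitrary: f n)
  case (pCons a p)
  have c: "twisted_coeff \<alpha> (deriv f) = act [:\<alpha>, 1:] (twisted_coeff \<alpha> f)"
    by (rule ext) (simp add: twisted_coeff_deriv pCons.prems act_pCons)
  have "twisted_coeff \<alpha> (poly_op (pCons a p) deriv f) n =
      a * twisted_coeff \<alpha> f n + twisted_coeff \<alpha> (poly_op p deriv (deriv f)) n"
    unfolding poly_op_pCons using pCons.prems
    by (subst twisted_coeff_add)
       (auto simp: twisted_coeff_cscale intro!: poly_op_deriv_entire entire_deriv
         cfun.subspace_scale[OF subspace_entire_functions])
  also have "twisted_coeff \<alpha> (poly_op p deriv (deriv f)) n =
      act (pcompose p [:\<alpha>, 1:] * [:\<alpha>, 1:]) (twisted_coeff \<alpha> f) n"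
    using pCons.IH[OF entire_deriv[OF pCons.prems]] c by (simp only: act_mult)
  finally show ?case
    by (simp add: pcompose_pCons act_add act_pCons mult.commute)
qed (simp add: poly_op_zero twisted_coeff_zero)

lemma poly_op_funpow_entire:
  "f \<in> entire_functions \<Longrightarrow> (poly_op p deriv ^^ n) f \<in> entire_functions"
  by (induction n) (auto intro: poly_op_deriv_entire)

lemma twisted_coeff_poly_op_funpow:
  assumes "f \<in> entire_functions"
  shows "twisted_coeff \<alpha> ((poly_op p deriv ^^ n) f) m = act (pcompose p [:\<alpha>, 1:] ^ n) (twisted_coeff \<alpha> f) m"
proof (induction n arbitrary: m)
  case 0
  show ?case by (simp add: one_pCons act_pCons)
next
  case (Suc n)
  then have "twisted_coeff \<alpha> ((poly_op p deriv ^^ n) f) = act (pcompose p [:\<alpha>, 1:] ^ n) (twisted_coeff \<alpha> f)"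
    by blast
  then show ?case
    by (simp add: twisted_coeff_poly_op poly_op_funpow_entire assms act_mult)
qed

section \<open>Power series, size estimates and reconstruction\<close>

lemma twisted_sums:
  assumes "f \<in> entire_functions"
  shows "(\<lambda>p. twisted_coeff \<alpha> f p / fact p * z ^ p) sums (exp (- \<alpha> * z) * f z)"
  using holomorphic_power_series[of "\<lambda>z. exp (- \<alpha> * z) * f z" 0 "norm z + 1" z]
    entire_twist[OF assms, of "- \<alpha>"]
  by (auto simp: twisted_coeff_def intro: holomorphic_on_subset)

lemma entire_seq_twisted:
  assumes "f \<in> entire_functions"
  shows "entire_seq (twisted_coeff \<alpha> f)"
proof (rule entire_seqI)
  fix r :: real assume r: "r \<ge> 1"
  \<comment> \<open>Convergence at the larger point \<open>r + 1\<close> gives absolute convergence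
    at \<open>r\<close>.\<close>
  have "summable (\<lambda>p. twisted_coeff \<alpha> f p / fact p * of_real (r + 1) ^ p)"
    using twisted_sums[OF assms] sums_summable by blast
  then have "summable (\<lambda>p. norm (twisted_coeff \<alpha> f p / fact p * of_real r ^ p))"
    by (rule powser_insidea) (use r in auto)
  then show "summable (\<lambda>p. norm (twisted_coeff \<alpha> f p) * r ^ p / fact p)"
    using r by (simp add: norm_mult norm_divide norm_power)
qed

text \<open>The power series of \<open>exp (- \<alpha> * z) * f z\<close> is bounded term by term;
  undoing the twist costs the factor \<open>exp (norm \<alpha> * r)\<close>. Smallness of
  \<open>seq_norm\<close> thereby yields uniform smallness on discs.\<close>

lemma norm_le_seq_norm_twisted:
  assumes "f \<in> entire_functions" "norm z \<le> r"
  shows "norm (f z) \<le> exp (norm \<alpha> * r) * seq_norm r (twisted_coeff \<alpha> f)"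
proof -
  have r: "r \<ge> 0" using assms(2) norm_ge_zero order_trans by blast
  let ?t = "\<lambda>p. twisted_coeff \<alpha> f p / fact p * z ^ p"
  have le: "norm (?t p) \<le> norm (twisted_coeff \<alpha> f p) * r ^ p / fact p" for p
    using assms(2) by (simp add: norm_mult norm_divide norm_power power_mono mult_left_mono divide_right_mono)
  have "norm (exp (- \<alpha> * z) * f z) = norm (\<Sum>p. ?t p)"
    using twisted_sums[OF assms(1)] by (simp add: sums_iff)
  also have "\<dots> \<le> seq_norm r (twisted_coeff \<alpha> f)"
    unfolding seq_norm_def by (intro norm_suminf_le le entire_seqD entire_seq_twisted assms(1))
  finally have *: "norm (exp (- \<alpha> * z) * f z) \<le> seq_norm r (twisted_coeff \<alpha> f)" .
  have "norm (exp (\<alpha> * z)) \<le> exp (norm \<alpha> * r)"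
  proof -
    have "norm (exp (\<alpha> * z)) \<le> exp (norm (\<alpha> * z))" by (rule norm_exp)
    also have "\<dots> \<le> exp (norm \<alpha> * r)" using assms(2) by (simp add: norm_mult mult_left_mono)
    finally show ?thesis .
  qed
  then have "norm (exp (\<alpha> * z)) * norm (exp (- \<alpha> * z) * f z) \<le> exp (norm \<alpha> * r) * seq_norm r (twisted_coeff \<alpha> f)"
    by (intro mult_mono *) auto
  moreover have "exp (\<alpha> * z) * (exp (- \<alpha> * z) * f z) = f z"
    by (simp add: exp_minus)
  ultimately show ?thesis by (metis norm_mult)
qed

lemma twisted_coeff_eq_zeroD:
  assumes "f \<in> entire_functions" "\<And>p. twisted_coeff \<alpha> f p = 0"
  shows "f = 0"
proof
  fix z
  have "norm (f z) \<le> exp (norm \<alpha> * norm z) * seq_norm (norm z) (twisted_coeff \<alpha> f)"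
    by (rule norm_le_seq_norm_twisted[OF assms(1)]) simp
  then show "f z = 0 z" by (simp add: assms(2) seq_norm_def)
qed

text \<open>The series with coefficients \<open>b p / fact p\<close> has infinite radius of
  convergence, and multiplying its sum by \<open>exp (\<alpha> * z)\<close> cancels the
  twist.\<close>

lemma ex_twisted_coeff:
  assumes "entire_seq b"
  shows "\<exists>f\<in>entire_functions. twisted_coeff \<alpha> f = b"
proof -
  let ?F = "Abs_fps (\<lambda>p. b p / fact p)"
  define h where "h = eval_fps ?F"
  have "summable (\<lambda>p. b p / fact p * z ^ p)" for z
    using entire_seqD[OF assms, of "norm z"]
    by (intro summable_norm_cancel[of "\<lambda>p. b p / fact p * z ^ p"]) (simp add: norm_mult norm_divide norm_power)
  then have R: "fps_conv_radius ?F = \<infinity>"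
    unfolding fps_conv_radius_def by (intro conv_radius_inftyI'') simp
  have h: "h holomorphic_on UNIV"
    unfolding h_def by (rule holomorphic_on_eval_fps) (simp add: R)
  have "(deriv ^^ p) h 0 = b p" for p
    using fps_nth_conv_deriv[of ?F p] R by (simp add: h_def)
  then have "twisted_coeff \<alpha> (\<lambda>z. exp (\<alpha> * z) * h z) = b"
    by (simp add: twisted_coeff_def fun_eq_iff mult.assoc[symmetric] exp_minus)
  moreover have "(\<lambda>z. exp (\<alpha> * z) * h z) \<in> entire_functions"
    using h by (auto simp: entire_functions_def intro!: holomorphic_intros)
  ultimately show ?thesis by blast
qed

lemma twisted_coeff_bound:
  assumes "f \<in> entire_functions" "\<And>z. norm z = 1 \<Longrightarrow> norm (f z) \<le> e"
  shows "norm (twisted_coeff \<alpha> f p) \<le> fact p * (exp (norm \<alpha>) * e)"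
proof -
  let ?g = "\<lambda>z. exp (- \<alpha> * z) * f z"
  have "norm ((deriv ^^ p) ?g 0) \<le> fact p * (exp (norm \<alpha>) * e) / 1 ^ p"
  proof (rule Cauchy_inequality)
    show "?g holomorphic_on ball 0 1" "continuous_on (cball 0 1) ?g"
      using entire_twist[OF assms(1), of "- \<alpha>"]
      by (auto intro: holomorphic_on_imp_continuous_on holomorphic_on_subset)
    fix w :: complex assume w: "norm (0 - w) = 1"
    have "norm (exp (- \<alpha> * w)) \<le> exp (norm \<alpha>)"
      using norm_exp[of "- \<alpha> * w"] w by (simp add: norm_mult)
    then show "norm (?g w) \<le> exp (norm \<alpha>) * e"
      using w by (auto simp: norm_mult intro!: mult_mono assms(2))
  qed simp
  then show ?thesis by (simp add: twisted_coeff_def)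
qed

section \<open>Comparison with the topology of the entire functions\<close>

lemma continuous_map_twisted_coeff:
  "continuous_map entire_topology euclidean (\<lambda>f. twisted_coeff \<alpha> f p)"
  unfolding continuous_map_def topspace_entire_topology
proof (intro conjI allI impI)
  fix U :: "complex set" assume "openin euclidean U"
  then have U: "open U" by simp
  show "openin entire_topology {f \<in> entire_functions. twisted_coeff \<alpha> f p \<in> U}"
    unfolding openin_entire_topology
  proof (intro conjI ballI)
    fix f assume "f \<in> {f \<in> entire_functions. twisted_coeff \<alpha> f p \<in> U}"
    then have f: "f \<in> entire_functions" "twisted_coeff \<alpha> f p \<in> U" by auto
    obtain e where e: "e > 0" "cball (twisted_coeff \<alpha> f p) e \<subseteq> U"
      using U f(2) open_contains_cball by blast
    \<comment> \<open>With this \<open>d\<close> the Cauchy estimate on the unit circle gives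
      exactly \<open>e\<close>. That estimate is not strict, hence the closed ball inside
      \<open>U\<close>.\<close>
    define d where "d = e / (fact p * exp (norm \<alpha>))"
    have "compact_nhd f (cball 0 1) d \<subseteq> {f \<in> entire_functions. twisted_coeff \<alpha> f p \<in> U}"
    proof
      fix g assume "g \<in> compact_nhd f (cball 0 1) d"
      then have g: "g \<in> entire_functions" and fg: "\<And>z. norm z \<le> 1 \<Longrightarrow> norm (f z - g z) < d"
        by (auto simp: compact_nhd_def dist_norm)
      have "norm (twisted_coeff \<alpha> (f - g) p) \<le> fact p * (exp (norm \<alpha>) * d)"
        using fg by (intro twisted_coeff_bound cfun.subspace_diff[OF subspace_entire_functions] f g)
          (auto intro: less_imp_le)
      then have "dist (twisted_coeff \<alpha> f p) (twisted_coeff \<alpha> g p) \<le> e"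
        by (simp add: twisted_coeff_diff f g dist_norm d_def)
      then show "g \<in> {f \<in> entire_functions. twisted_coeff \<alpha> f p \<in> U}"
        using e g by auto
    qed
    then show "\<exists>K e. compact K \<and> e > 0 \<and> compact_nhd f K e \<subseteq> {f \<in> entire_functions. twisted_coeff \<alpha> f p \<in> U}"
      using e by (intro exI[of _ "cball 0 1"] exI[of _ d]) (auto simp: d_def)
  qed auto
qed auto

text \<open>Every compact set lies in a disc of radius at least 1, and the shift estimates are
  available for exactly these radii.\<close>

lemma hypercyclic_vectorI:
  assumes "f \<in> entire_functions"
    and T: "\<And>h. h \<in> entire_functions \<Longrightarrow> T h \<in> entire_functions"
    and approx: "\<And>g r e. g \<in> entire_functions \<Longrightarrow> r \<ge> 1 \<Longrightarrow> e > 0 \<Longrightarrow>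
      \<exists>n\<ge>1. \<forall>z\<in>cball 0 r. norm ((T ^^ n) f z - g z) < e"
  shows "hypercyclic_vector T f"
proof -
  have Tn: "(T ^^ n) f \<in> entire_functions" for n
    by (induction n) (auto intro: assms)
  have "g \<in> entire_topology closure_of {(T ^^ n) f | n. n \<ge> 1}" if g: "g \<in> entire_functions" for g
    unfolding in_closure_of topspace_entire_topology
  proof (intro conjI allI impI g)
    fix U assume "g \<in> U \<and> openin entire_topology U"
    then obtain K e where K: "compact K" "e > 0" "compact_nhd g K e \<subseteq> U"
      unfolding openin_entire_topology by blast
    obtain r where r: "\<forall>z\<in>K. norm z \<le> r"
      using compact_imp_bounded[OF K(1)] by (auto simp: bounded_iff)
    obtain n where n: "n \<ge> 1" "\<forall>z\<in>cball 0 (max 1 r). norm ((T ^^ n) f z - g z) < e"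
      using approx[OF g, of "max 1 r" e] K(2) by auto
    have "(T ^^ n) f \<in> compact_nhd g K e"
      using n(2) r Tn by (auto simp: compact_nhd_def dist_norm norm_minus_commute le_max_iff_disj)
    then show "\<exists>y. y \<in> {(T ^^ n) f | n. n \<ge> 1} \<and> y \<in> U"
      using K(3) n(1) by blast
  qed
  then show ?thesis
    using closure_of_subset_topspace[of entire_topology] assms(1)
    unfolding hypercyclic_vector_def topspace_entire_topology by blast
qed

section \<open>Inverting the action on finitely supported sequences\<close>

text \<open>On sequences supported in \<open>{0..N}\<close> the shift is nilpotent, and a polynomial
  with non-zero constant term is a unit modulo the power \<open>Suc N\<close> of the variable.
  Bezout gives one inverse \<open>S\<close> for all such sequences.\<close>

lemma ex_act_inverse:
  assumes "coeff R 0 \<noteq> 0"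
  shows "\<exists>S. \<forall>x. (\<forall>p>N. x p = 0) \<longrightarrow> act R (act S x) = x"
proof -
  have "\<not> [:0, 1:] dvd R"
    using assms by (metis dvd_iff_poly_eq_0 minus_zero poly_0_coeff_0)
  then have "coprime [:0, 1:] R"
    by (intro prime_elem_imp_coprime prime_elem_linear_field_poly) simp_all
  then have "coprime R ([:0, 1:] ^ Suc N)"
    by (simp add: coprime_commute del: power_Suc)
  then obtain S H where "S * R + H * [:0, 1:] ^ Suc N = 1"
    by (metis bezout_coefficients_fst_snd coprime_imp_gcd_eq_1)
  then have 1: "R * S + monom 1 (Suc N) * H = 1"
    by (simp add: monom_altdef mult.commute)
  have "act R (act S x) p = x p" if x: "\<forall>p>N. x p = 0" for x p
  proof -
    \<comment> \<open>The shift by \<open>Suc N\<close> makes \<open>H\<close> read only entries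
      beyond the support.\<close>
    have "act (monom 1 (Suc N) * H) x p = 0"
      unfolding act_monom_mult by (simp add: act_def x)
    then have "act (R * S + monom 1 (Suc N) * H) x p = act R (act S x) p"
      by (simp only: act_add act_mult[of R] add_0_right)
    then show ?thesis
      unfolding 1 by (simp add: one_pCons act_pCons)
  qed
  then show ?thesis by blast
qed

lemma norm_act_le:
  assumes "\<And>p. norm (x p) \<le> B"
  shows "norm (act S x p) \<le> (\<Sum>j\<le>degree S. norm (coeff S j)) * B"
proof -
  have "norm (act S x p) \<le> (\<Sum>j\<le>degree S. norm (coeff S j) * B)"
    unfolding act_def by (rule sum_norm_le) (simp add: norm_mult mult_left_mono assms)
  then show ?thesis by (simp add: sum_distrib_right)
qed

text \<open>The inverse \<open>S\<close> is iterated. The action looks only forward, so supports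
  stay in \<open>{0..N}\<close> and the same \<open>S\<close> works at every step; entries grow at
  most geometrically.\<close>

lemma ex_preimages_geometric:
  assumes "coeff R 0 \<noteq> 0" "\<And>p. p > N \<Longrightarrow> q p = 0"
  shows "\<exists>C B v. C \<ge> 1 \<and> B \<ge> 0 \<and> (\<forall>n p. norm (v n p) \<le> C ^ n * B) \<and>
    (\<forall>n. \<forall>p>N. v n p = 0) \<and> (\<forall>n. act (R ^ n) (v n) = q)"
proof -
  obtain S where S: "\<And>x. (\<forall>p>N. x p = 0) \<Longrightarrow> act R (act S x) = x"
    using ex_act_inverse[OF assms(1), of N] by blast
  \<comment> \<open>The maximum with 1 makes \<open>C ^ n\<close> nondecreasing in \<open>n\<close>,
    so that \<open>n\<close> may later be replaced by a larger exponent.\<close>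
  define C where "C = max 1 (\<Sum>j\<le>degree S. norm (coeff S j))"
  define B where "B = (\<Sum>p\<le>N. norm (q p))"
  define v where "v n = (act S ^^ n) q" for n
  have supp: "v n p = 0" if "p > N" for n p
    using that by (induction n arbitrary: p) (auto simp: v_def assms(2) act_def)
  have B: "B \<ge> 0" unfolding B_def by (intro sum_nonneg) auto
  have bound: "norm (v n p) \<le> C ^ n * B" for n p
  proof (induction n arbitrary: p)
    case 0
    show ?case
    proof (cases "p \<le> N")
      case True
      then show ?thesis unfolding B_def v_def by (auto intro!: member_le_sum)
    next
      case False
      then show ?thesis using B by (simp add: v_def assms(2))
    qed
  next
    case (Suc n)
    have "norm (v (Suc n) p) \<le> (\<Sum>j\<le>degree S. norm (coeff S j)) * (C ^ n * B)"
      unfolding v_def funpow.simps comp_def using Suc unfolding v_def by (rule norm_act_le)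
    also have "\<dots> \<le> C * (C ^ n * B)"
      using B by (intro mult_right_mono) (auto simp: C_def)
    finally show ?case by (simp add: mult.assoc)
  qed
  have "act (R ^ n) (v n) = q" for n
  proof (induction n)
    case 0
    show ?case by (simp add: v_def one_pCons act_pCons fun_eq_iff)
  next
    case (Suc n)
    have "act (R ^ Suc n) (v (Suc n)) p = act (R ^ n) (act R (act S (v n))) p" for p
      unfolding power_Suc2 act_mult by (simp add: v_def)
    then show ?case using S[of "v n"] supp Suc by (simp add: fun_eq_iff)
  qed
  moreover have "C \<ge> 1" by (simp add: C_def)
  ultimately show ?thesis using B bound supp by blast
qed

text \<open>Geometric growth loses against the factorial once the preimage is moved up to start at
  exponent \<open>k * n\<close>. All exponents \<open>k * n + s\<close> are at least
  \<open>n\<close>, so one large \<open>n\<close> handles every \<open>s\<close>.\<close>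

lemma ex_small_preimage:
  fixes k N M :: nat
  assumes "coeff R 0 \<noteq> 0" "\<And>p. p > N \<Longrightarrow> q p = 0" "k \<ge> 1" "r \<ge> 1"
  shows "\<exists>n v. n \<ge> M \<and> act (R ^ n) v = q \<and> (\<forall>p>N. v p = 0) \<and>
    (\<forall>s. norm (v s) * r ^ (k * n + s) / fact (k * n + s) \<le> 1)"
proof -
  obtain C B v where v: "C \<ge> 1" "B \<ge> 0" "\<And>n p. norm (v n p) \<le> C ^ n * B"
     "\<And>n p. p > N \<Longrightarrow> v n p = 0" "\<And>n. act (R ^ n) (v n) = q"
    using ex_preimages_geometric[of R N q, OF assms(1,2)] by blast
  have "(\<lambda>t. inverse (fact t) * (C * r) ^ t) \<longlonglongrightarrow> 0"
    by (rule summable_LIMSEQ_zero[OF summable_exp])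
  from tendsto_mult_right_zero[OF this, of B]
  have "eventually (\<lambda>t. B * (inverse (fact t) * (C * r) ^ t) < 1) sequentially"
    by (rule order_tendstoD) simp
  then obtain T where T: "\<And>t. t \<ge> T \<Longrightarrow> B * (inverse (fact t) * (C * r) ^ t) < 1"
    by (auto simp: eventually_sequentially)
  define n where "n = max M T"
  have "norm (v n s) * r ^ (k * n + s) / fact (k * n + s) \<le> 1" for s
  proof -
    let ?t = "k * n + s"
    have nt: "n \<le> ?t" using assms(3) by (cases k) auto
    have "norm (v n s) \<le> C ^ ?t * B"
      using v(3)[of n s] power_increasing[OF nt v(1)] v(2) by (meson mult_right_mono order_trans)
    then have "norm (v n s) * (r ^ ?t / fact ?t) \<le> (C ^ ?t * B) * (r ^ ?t / fact ?t)"
      using assms(4) by (intro mult_right_mono) auto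
    also have "\<dots> = B * (inverse (fact ?t) * (C * r) ^ ?t)"
      by (simp add: power_mult_distrib divide_inverse mult_ac)
    also have "\<dots> < 1" using nt by (intro T) (auto simp: n_def)
    finally show ?thesis by simp
  qed
  moreover have "n \<ge> M" by (simp add: n_def)
  ultimately show ?thesis using v(4,5) by blast
qed

text \<open>The family consists of the finite lists over a countable dense set of complex numbers,
  coded as lists of natural numbers. A small tail of \<open>b\<close> is dropped and the remaining
  entries are approximated one by one.\<close>

lemma ex_dense_finite_sequences:
  "\<exists>(N :: nat \<Rightarrow> nat) q. (\<forall>l. \<forall>p>N l. q l p = (0::complex)) \<and>
     (\<forall>b r e. entire_seq b \<longrightarrow> r \<ge> 0 \<longrightarrow> e > 0 \<longrightarrow> (\<exists>l. seq_norm r (\<lambda>p. q l p - b p) < e))"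
proof -
  obtain D :: "complex set" where D: "countable D" "\<And>X. open X \<Longrightarrow> X \<noteq> {} \<Longrightarrow> \<exists>d\<in>D. d \<in> X"
    using countable_dense_exists by blast
  have "D \<noteq> {}" using D(2)[of UNIV] by auto
  define d where "d = from_nat_into D"
  have d: "\<exists>n. norm (d n - z) < e" if "e > 0" for z e
  proof -
    have "\<exists>x\<in>D. x \<in> ball z e" using that by (intro D(2)) auto
    then obtain x where "x \<in> D" "x \<in> ball z e" by blast
    then show ?thesis
      using from_nat_into_surj[OF D(1), of x] by (auto simp: d_def dist_norm norm_minus_commute)
  qed
  define N :: "nat \<Rightarrow> nat" where "N l = length (from_nat l :: nat list)" for l
  define q where "q l p = (if p < N l then d ((from_nat l :: nat list) ! p) else 0)" for l p
  have "\<exists>l. seq_norm r (\<lambda>p. q l p - b p) < e" if b: "entire_seq b" and r: "r \<ge> 0" and e: "e > 0" for b r e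
  proof -
    obtain M where M: "seq_norm r (seq_tail M b) < e / 2"
      using seq_norm_tail_small[OF b r, of "e / 2"] e by auto
    define S where "S = (\<Sum>p<M. r ^ p / fact p)"
    have S: "S \<ge> 0" unfolding S_def using r by (intro sum_nonneg) auto
    \<comment> \<open>Half of \<open>e\<close> is left for the first \<open>M\<close> entries, whose
      total weight is \<open>S\<close>; the summand 1 keeps the denominator positive.\<close>
    define \<delta> where "\<delta> = e / 2 / (1 + S)"
    have \<delta>: "\<delta> > 0" using e S by (simp add: \<delta>_def)
    have "\<exists>n. norm (d n - b p) < \<delta>" for p by (rule d[OF \<delta>])
    then obtain ix where ix: "\<And>p. norm (d (ix p) - b p) < \<delta>" by metis
    \<comment> \<open>This index codes the list that selects an approximant for each of the first
      \<open>M\<close> entries.\<close>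
    define l where "l = to_nat (map ix [0..<M])"
    define u where "u p = (if p < M then d (ix p) - b p else 0)" for p
    have split: "q l p - b p = u p + (- 1) * seq_tail M b p" for p
      by (auto simp: q_def N_def l_def u_def seq_tail_def)
    have u: "entire_seq u"
      unfolding entire_seq_def
      by (intro allI summable_finite[of "{..<M}"]) (auto simp: u_def)
    have "seq_norm r u = (\<Sum>p<M. norm (u p) * r ^ p / fact p)"
      unfolding seq_norm_def by (rule suminf_finite) (auto simp: u_def)
    also have "\<dots> \<le> (\<Sum>p<M. \<delta> * (r ^ p / fact p))"
    proof (intro sum_mono)
      fix p assume "p \<in> {..<M}"
      then have "norm (u p) \<le> \<delta>" using ix[of p] by (simp add: u_def less_imp_le)
      then have "norm (u p) * (r ^ p / fact p) \<le> \<delta> * (r ^ p / fact p)"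
        using r by (intro mult_right_mono) auto
      then show "norm (u p) * r ^ p / fact p \<le> \<delta> * (r ^ p / fact p)" by simp
    qed
    also have "\<dots> = \<delta> * S" by (simp add: S_def sum_distrib_left)
    also have "\<dots> \<le> e / 2" using e S by (simp add: \<delta>_def field_simps)
    finally have 1: "seq_norm r u \<le> e / 2" .
    have "seq_norm r (\<lambda>p. q l p - b p) \<le> seq_norm r u + seq_norm r (\<lambda>p. (- 1) * seq_tail M b p)"
      unfolding split by (intro seq_norm_triangle u entire_seq_cmult entire_seq_tail b r)
    also have "\<dots> < e"
      using 1 M by (subst seq_norm_cmult) (auto intro: entire_seq_tail b)
    finally show ?thesis by blast
  qed
  moreover have "\<forall>l. \<forall>p>N l. q l p = 0" by (simp add: q_def)
  ultimately show ?thesis by blast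
qed

section \<open>The subspace\<close>

text \<open>Here \<open>v i\<close> lists the coefficients of the preimage \<open>y\<^sub>i\<close> from exponent \<open>k * n i\<close> on, and
  \<open>\<kappa> i = j\<close> says that \<open>y\<^sub>i\<close> is attached to \<open>z ^ m j\<close>. All coefficients are those of \<open>z ^ p / fact p\<close>.\<close>

locale block_construction =
  fixes P R :: "complex poly" and \<alpha> :: complex and k :: nat
    and m n N \<kappa> :: "nat \<Rightarrow> nat" and q v :: "nat \<Rightarrow> nat \<Rightarrow> complex"
  assumes twist: "pcompose P [:\<alpha>, 1:] = monom 1 k * R"
    and m_less: "m i < k * n i"
    and less_m: "k * n i + N i < m (Suc i)"
    and const_le: "act_const (pcompose P [:\<alpha>, 1:] ^ n i) \<le> 2 ^ m (Suc i)"
    and act_v: "act (R ^ n i) (v i) = q i"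
    and v_supp: "p > N i \<Longrightarrow> v i p = 0"
    and v_small: "norm (v i s) * (2 * (real i + 1)) ^ (k * n i + s) / fact (k * n i + s) \<le> 1"
    and dense: "entire_seq b \<Longrightarrow> r \<ge> 0 \<Longrightarrow> e > 0 \<Longrightarrow>
      \<exists>i\<ge>I. \<kappa> i = j \<and> seq_norm r (\<lambda>p. q i p - b p) < e"
begin

abbreviation block :: "nat \<Rightarrow> nat set" where
  "block i \<equiv> {k * n i..k * n i + N i}"

text \<open>Given as a solution set rather than as the closed span of generators, so that closedness
  follows from continuity of the coefficients alone.\<close>

definition M :: "(complex \<Rightarrow> complex) set" where
  "M = {f \<in> entire_functions.
     (\<forall>i. \<forall>s\<le>N i. twisted_coeff \<alpha> f (k * n i + s) = twisted_coeff \<alpha> f (m (\<kappa> i)) * v i s) \<and>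
     (\<forall>p. p \<notin> range m \<longrightarrow> (\<forall>i. p \<notin> block i) \<longrightarrow> twisted_coeff \<alpha> f p = 0)}"

section \<open>Relative position of the exponents \<open>m i\<close> and the blocks\<close>

lemma strict_mono_m: "strict_mono m"
  using m_less less_m by (intro strict_mono_Suc_iff[THEN iffD2]) (metis add_lessD1 less_trans)

lemma m_le_iff: "m i \<le> m j \<longleftrightarrow> i \<le> j"
  and m_less_iff: "m i < m j \<longleftrightarrow> i < j"
  and m_eq_iff: "m i = m j \<longleftrightarrow> i = j"
  using strict_mono_m by (auto simp: strict_mono_less_eq strict_mono_less strict_mono_eq)

lemma between_block: "p \<in> block i \<Longrightarrow> m i < p \<and> p < m (Suc i)"
  using m_less[of i] less_m[of i] by auto

lemma between_unique:
  assumes "m i < p" "p < m (Suc i)" "m j \<le> p" "p < m (Suc j)"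
  shows "i = j"
proof -
  have "m i < m (Suc j)" "m j < m (Suc i)" using assms by auto
  then show ?thesis by (simp add: m_less_iff)
qed

lemma m_notin_block: "m j \<notin> block i"
  using between_block[of "m j" i] by (auto simp: m_less_iff)

section \<open>Linearity and closedness\<close>

lemma subspace_M: "cfun.subspace M"
proof (rule cfun.subspaceI)
  show "0 \<in> M"
    using cfun.subspace_0[OF subspace_entire_functions] by (simp add: M_def twisted_coeff_zero)
  show "f + g \<in> M" if "f \<in> M" "g \<in> M" for f g
    using that cfun.subspace_add[OF subspace_entire_functions]
    by (simp add: M_def twisted_coeff_add algebra_simps)
  show "cscale c f \<in> M" if "f \<in> M" for c f
    using that cfun.subspace_scale[OF subspace_entire_functions]
    by (simp add: M_def twisted_coeff_cscale algebra_simps)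
qed

lemma closedin_M: "closedin entire_topology M"
proof -
  \<comment> \<open>A triple \<open>(p, p', c)\<close> stands for the equation that entry
    \<open>p\<close> is \<open>c\<close> times entry \<open>p'\<close>. The vanishing conditions are
    the triples with \<open>c = 0\<close>.\<close>
  define F where "F t = (case t of (p, p', c) \<Rightarrow>
      {f \<in> entire_functions. twisted_coeff \<alpha> f p - twisted_coeff \<alpha> f p' * c = 0})" for t
  define C where "C = (\<Union>i. (\<lambda>s. (k * n i + s, m (\<kappa> i), v i s)) ` {..N i}) \<union>
      (\<lambda>p. (p, 0, 0)) ` {p. p \<notin> range m \<and> (\<forall>i. p \<notin> block i)}"
  have F: "closedin entire_topology (F t)" for t
  proof -
    obtain p p' c where t: "t = (p, p', c)" by (cases t) blast
    have "continuous_map entire_topology euclidean (\<lambda>f. twisted_coeff \<alpha> f p - twisted_coeff \<alpha> f p' * c)"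
      using continuous_map_compose[OF continuous_map_twisted_coeff[of \<alpha> p'], of euclidean "\<lambda>x. x * c"]
      by (intro continuous_map_diff continuous_map_twisted_coeff) (auto simp: o_def continuous_on_mult_right)
    from closedin_continuous_map_preimage[OF this, of "{0}"]
    show ?thesis by (simp add: topspace_entire_topology F_def t)
  qed
  have "f \<in> M \<longleftrightarrow> f \<in> entire_functions \<and> (\<forall>t\<in>C. f \<in> F t)" for f
    unfolding M_def C_def ball_Un ball_UN by (simp add: F_def) blast
  then have "M = \<Inter>(insert entire_functions (F ` C))" by blast
  moreover have "closedin entire_topology (\<Inter>(insert entire_functions (F ` C)))"
    using F closedin_topspace[of entire_topology]
    by (intro closedin_Inter) (auto simp: topspace_entire_topology)
  ultimately show ?thesis by simp
qed

text \<open>The coefficients of the element of \<open>M\<close> with entry 1 at \<open>m j\<close>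
  and 0 at every other \<open>m i\<close>. Blocks are disjoint, so the sum has at most one term and
  acts as a case distinction.\<close>

definition seed :: "nat \<Rightarrow> nat \<Rightarrow> complex" where
  "seed j p = of_bool (p = m j) + (\<Sum>i | \<kappa> i = j \<and> p \<in> block i. v i (p - k * n i))"

lemma seed_block:
  assumes "p \<in> block i"
  shows "seed j p = (if \<kappa> i = j then v i (p - k * n i) else 0)"
proof -
  have unique: "i' = i" if "p \<in> block i'" for i'
    using between_unique[of i p i'] between_block[OF assms] between_block[OF that] by simp
  have eq: "\<kappa> i' = j \<and> p \<in> block i' \<longleftrightarrow> i' = i \<and> \<kappa> i = j" for i'
    using assms unique[of i'] by metis
  have "p \<noteq> m j" using assms m_notin_block[of j i] by metis
  then show ?thesis
    unfolding seed_def eq by simp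
qed

lemma seed_not_block: "(\<And>i. p \<notin> block i) \<Longrightarrow> seed j p = of_bool (p = m j)"
  unfolding seed_def by (simp del: atLeastAtMost_iff)

lemma seed_m: "seed j (m i) = of_bool (i = j)"
  using m_notin_block by (subst seed_not_block) (auto simp: m_eq_iff)

text \<open>In block \<open>i\<close> the bound \<open>v_small\<close> holds at radius
  \<open>2 * (real i + 1)\<close>, which is at least \<open>2 * r\<close> from some \<open>i\<close>
  on. The spare factor 2 leaves a geometric series as majorant.\<close>

lemma entire_seq_seed: "entire_seq (seed j)"
proof (rule entire_seqI)
  fix r :: real assume r: "r \<ge> 1"
  obtain I :: nat where I: "r \<le> I" using real_arch_simple by blast
  \<comment> \<open>From \<open>m ?I\<close> on only blocks of index at least \<open>I\<close>
    occur, and the exponent \<open>m j\<close> has been passed.\<close>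
  let ?I = "max I (Suc j)"
  have "norm (norm (seed j p) * r ^ p / fact p) \<le> (1 / 2) ^ p" if p: "p \<ge> m ?I" for p
  proof (cases "\<exists>i. p \<in> block i")
    case True
    then obtain i where i: "p \<in> block i" by blast
    have "m ?I < m (Suc i)" using between_block[OF i] p by simp
    then have "r \<le> real i + 1" using I by (simp add: m_less_iff)
    then have "(2 * r) ^ p \<le> (2 * (real i + 1)) ^ p" using r by (intro power_mono) auto
    then have "norm (seed j p) * ((2 * r) ^ p / fact p) \<le> norm (seed j p) * ((2 * (real i + 1)) ^ p / fact p)"
      by (intro mult_left_mono divide_right_mono) auto
    also have "\<dots> \<le> norm (v i (p - k * n i)) * ((2 * (real i + 1)) ^ p / fact p)"
      using seed_block[OF i, of j] by (intro mult_right_mono) auto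
    also have "\<dots> \<le> 1" using v_small[of i "p - k * n i"] i by simp
    finally show ?thesis
      using r by (simp add: power_mult_distrib power_divide abs_mult field_simps)
  next
    case False
    have "p \<noteq> m j" using p m_le_iff[of ?I j] by auto
    then show ?thesis using False by (simp add: seed_not_block)
  qed
  then show "summable (\<lambda>p. norm (seed j p) * r ^ p / fact p)"
    by (intro summable_comparison_test[OF _ summable_geometric[of "1 / 2 :: real"]]) auto
qed

lemma ex_seed_function: "\<exists>f\<in>M. twisted_coeff \<alpha> f = seed j"
proof -
  obtain f where f: "f \<in> entire_functions" "twisted_coeff \<alpha> f = seed j"
    using ex_twisted_coeff[OF entire_seq_seed] by blast
  have "seed j p = 0" if "p \<notin> range m" "\<forall>i. p \<notin> block i" for p
    using that by (subst seed_not_block) auto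
  moreover have "seed j (k * n i + s) = seed j (m (\<kappa> i)) * v i s" if "s \<le> N i" for i s
    using that by (subst seed_block[of _ i]) (auto simp: seed_m)
  ultimately have "f \<in> M" using f by (simp add: M_def)
  then show ?thesis using f by blast
qed

text \<open>The coefficient at \<open>m j\<close> is a linear functional that vanishes on every seed
  function except the \<open>j\<close>-th, so the seed functions are an infinite independent
  family.\<close>

lemma not_finitely_spanned: "\<not> (\<exists>B. finite B \<and> cfun.span B = M)"
proof
  assume "\<exists>B. finite B \<and> cfun.span B = M"
  then obtain B where B: "finite B" "cfun.span B = M" by blast
  obtain F where F: "\<And>j. F j \<in> M" "\<And>j. twisted_coeff \<alpha> (F j) = seed j"
    using ex_seed_function by metis
  have "inj F"
    by (rule injI) (metis F(2) of_bool_eq_1_iff seed_m)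
  have "cfun.independent (range F)"
    unfolding cfun.dependent_def
  proof
    assume "\<exists>a\<in>range F. a \<in> cfun.span (range F - {a})"
    then obtain j where j: "F j \<in> cfun.span (range F - {F j})" by blast
    let ?V = "{f \<in> entire_functions. twisted_coeff \<alpha> f (m j) = 0}"
    have "cfun.subspace ?V"
      using subspace_entire_functions
      by (auto simp: cfun.subspace_def twisted_coeff_zero twisted_coeff_add twisted_coeff_cscale)
    moreover have "range F - {F j} \<subseteq> ?V"
      using F by (auto simp: seed_m M_def)
    ultimately have "F j \<in> ?V" using j cfun.span_minimal by blast
    then show False by (simp add: F seed_m)
  qed
  moreover have "range F \<subseteq> cfun.span B" using F B by auto
  ultimately have "finite (range F)"
    using cfun.independent_span_bound[OF B(1)] by blast
  then show False using \<open>inj F\<close> by (simp add: finite_image_iff)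
qed

section \<open>Hypercyclicity of the non-zero vectors\<close>

lemma act_split:
  assumes "f \<in> M"
  shows "act (pcompose P [:\<alpha>, 1:] ^ n i) (twisted_coeff \<alpha> f) p =
    twisted_coeff \<alpha> f (m (\<kappa> i)) * q i p +
    act (pcompose P [:\<alpha>, 1:] ^ n i) (seq_tail (m (Suc i)) (twisted_coeff \<alpha> f)) p"
proof -
  let ?Q = "pcompose P [:\<alpha>, 1:]" and ?b = "twisted_coeff \<alpha> f"
  \<comment> \<open>The part of \<open>f\<close> below \<open>m (Suc i)\<close>. The shift by
    \<open>k * n i\<close> discards all of it before block \<open>i\<close>, and what remains is a
    multiple of \<open>v i\<close>, whose image under \<open>R ^ n i\<close> is known
    exactly.\<close>
  define Z where "Z p = (if p < m (Suc i) then ?b p else 0)" for p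
  have Z: "Z (s + k * n i) = ?b (m (\<kappa> i)) * v i s" for s
  proof (cases "s \<le> N i")
    case True
    then show ?thesis
      using assms less_m[of i] unfolding Z_def M_def by (simp add: add.commute)
  next
    case False
    \<comment> \<open>Between the end of block \<open>i\<close> and \<open>m (Suc i)\<close> there
      is neither a block nor some \<open>m i'\<close>, so membership in \<open>M\<close> forces the
      coefficient to vanish.\<close>
    have "?b (s + k * n i) = 0" if "s + k * n i < m (Suc i)"
    proof -
      have lo: "m i < s + k * n i" using m_less[of i] by simp
      have "s + k * n i \<notin> range m"
        using lo that by (auto simp: m_less_iff)
      moreover have "s + k * n i \<notin> block i'" for i'
        using between_unique[OF lo that, of i'] between_block[of "s + k * n i" i'] False by auto
      ultimately show ?thesis using assms by (simp add: M_def)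
    qed
    then show ?thesis using False by (simp add: Z_def v_supp)
  qed
  have "?b = (\<lambda>p. Z p + seq_tail (m (Suc i)) ?b p)"
    by (auto simp: Z_def seq_tail_def)
  then have "act (?Q ^ n i) ?b p = act (?Q ^ n i) Z p + act (?Q ^ n i) (seq_tail (m (Suc i)) ?b) p"
    by (metis act_seq_add)
  moreover have "act (?Q ^ n i) Z p = act (R ^ n i) Z (p + k * n i)"
    by (simp add: twist power_mult_distrib monom_power act_monom_mult)
  moreover have "\<dots> = act (R ^ n i) (\<lambda>s. Z (s + k * n i)) p"
    by (simp add: act_def algebra_simps)
  moreover have "\<dots> = ?b (m (\<kappa> i)) * q i p"
    by (simp add: Z act_seq_cmult act_v)
  ultimately show ?thesis by simp
qed

lemma hypercyclic_M:
  assumes f: "f \<in> M" and nz: "f \<noteq> 0"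
  shows "hypercyclic_vector (poly_op P deriv) f"
proof -
  let ?Q = "pcompose P [:\<alpha>, 1:]" and ?b = "twisted_coeff \<alpha> f"
  have fE: "f \<in> entire_functions" using f by (simp add: M_def)
  obtain p where "?b p \<noteq> 0" using twisted_coeff_eq_zeroD[OF fE] nz by blast
  \<comment> \<open>A non-zero coefficient inside block \<open>i\<close> is a multiple of the one at
    \<open>m (\<kappa> i)\<close>; outside the blocks it can only sit at some
    \<open>m j\<close>.\<close>
  have "\<exists>j. ?b (m j) \<noteq> 0"
  proof (cases "\<exists>i. p \<in> block i")
    case True
    then obtain i where "p \<in> block i" by blast
    then obtain s where "s \<le> N i" "p = k * n i + s" by (auto simp: le_iff_add)
    then show ?thesis using f \<open>?b p \<noteq> 0\<close> by (auto simp: M_def)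
  next
    case False
    then have "p \<in> range m" using f \<open>?b p \<noteq> 0\<close> unfolding M_def by blast
    then show ?thesis using \<open>?b p \<noteq> 0\<close> by blast
  qed
  then obtain j where j: "?b (m j) \<noteq> 0" by blast
  define a where "a = ?b (m j)"
  have a: "a \<noteq> 0" using j by (simp add: a_def)
  show ?thesis
  proof (rule hypercyclic_vectorI[OF fE poly_op_deriv_entire])
    fix g and r e :: real
    assume g: "g \<in> entire_functions" and r: "r \<ge> 1" and e: "e > 0"
    \<comment> \<open>The main term of the orbit is \<open>a * q i\<close>, so \<open>q i\<close>
      has to approximate the target divided by \<open>a\<close>.\<close>
    let ?c = "\<lambda>p. inverse a * twisted_coeff \<alpha> g p"
    \<comment> \<open>Two errors below \<open>d\<close> each, times
      \<open>exp (norm \<alpha> * r)\<close> for undoing the twist, stay below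
      \<open>e\<close>.\<close>
    define d where "d = e / exp (norm \<alpha> * r) / 2"
    have d: "d > 0" using e by (simp add: d_def)
    \<comment> \<open>One doubling of the radius pays for the action of \<open>?Q ^ n i\<close>; the
      other absorbs its constant by means of \<open>const_le\<close>.\<close>
    obtain L where L: "\<And>l. l \<ge> L \<Longrightarrow> seq_norm (2 * (2 * r)) (seq_tail l ?b) < d"
      using seq_norm_tail_small[OF entire_seq_twisted[OF fE], of "2 * (2 * r)" d] r d by auto
    have c: "entire_seq ?c" by (intro entire_seq_cmult entire_seq_twisted g)
    obtain i where i: "i \<ge> L" "\<kappa> i = j" "seq_norm r (\<lambda>p. q i p - ?c p) < d / norm a"
      using dense[OF c, of r "d / norm a" L j] r d a by auto
    let ?t = "seq_tail (m (Suc i)) ?b"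
    let ?h = "(poly_op P deriv ^^ n i) f - g"
    have h: "?h \<in> entire_functions"
      by (intro cfun.subspace_diff[OF subspace_entire_functions] poly_op_funpow_entire fE g)
    have t: "entire_seq ?t" by (intro entire_seq_tail entire_seq_twisted fE)
    have "entire_seq (v i)"
      unfolding entire_seq_def using v_supp[of i]
      by (intro allI summable_finite[of "{..N i}"]) auto
    then have "entire_seq (q i)" unfolding act_v[of i, symmetric] by (rule entire_seq_act)
    from entire_seq_add[OF this entire_seq_cmult[OF c, of "-1"]]
    have qc: "entire_seq (\<lambda>p. q i p - ?c p)" by simp
    have "twisted_coeff \<alpha> ?h = (\<lambda>p. a * (q i p - ?c p) + act (?Q ^ n i) ?t p)"
      using a by (simp add: fun_eq_iff twisted_coeff_diff poly_op_funpow_entire fE g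
          twisted_coeff_poly_op_funpow act_split[OF f] i(2) a_def[symmetric] algebra_simps)
    then have "seq_norm r (twisted_coeff \<alpha> ?h) \<le> norm a * seq_norm r (\<lambda>p. q i p - ?c p) + seq_norm r (act (?Q ^ n i) ?t)"
      using seq_norm_triangle[OF entire_seq_cmult[OF qc, of a] entire_seq_act[OF t], of r] r
      by (simp add: seq_norm_cmult[OF qc])
    moreover have "norm a * seq_norm r (\<lambda>p. q i p - ?c p) < d"
      using i(3) a by (simp add: field_simps)
    moreover have "seq_norm r (act (?Q ^ n i) ?t) < d"
    proof -
      have "seq_norm r (act (?Q ^ n i) ?t) \<le> act_const (?Q ^ n i) * seq_norm (2 * r) ?t"
        by (rule seq_norm_act[OF t r])
      also have "\<dots> \<le> 2 ^ m (Suc i) * seq_norm (2 * r) ?t"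
        using r by (intro mult_right_mono const_le seq_norm_nonneg t) auto
      also have "\<dots> \<le> seq_norm (2 * (2 * r)) ?t"
        using r by (intro seq_norm_tail_le entire_seq_twisted fE) auto
      also have "\<dots> < d"
        using strict_mono_imp_increasing[OF strict_mono_m, of "Suc i"] i(1) by (intro L) simp
      finally show ?thesis .
    qed
    ultimately have small: "seq_norm r (twisted_coeff \<alpha> ?h) < 2 * d" by simp
    have "norm ((poly_op P deriv ^^ n i) f z - g z) < e" if "z \<in> cball 0 r" for z
    proof -
      have "norm (?h z) \<le> exp (norm \<alpha> * r) * seq_norm r (twisted_coeff \<alpha> ?h)"
        using that by (intro norm_le_seq_norm_twisted h) simp
      also have "\<dots> < exp (norm \<alpha> * r) * (2 * d)"
        using small by simp
      also have "\<dots> = e" by (simp add: d_def)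
      finally show ?thesis by simp
    qed
    moreover have "n i \<ge> 1" using m_less[of i] by (cases "n i") auto
    ultimately show "\<exists>n\<ge>1. \<forall>z\<in>cball 0 r. norm ((poly_op P deriv ^^ n) f z - g z) < e"
      by blast
  qed
qed

lemma hypercyclic_subspace_M: "hypercyclic_subspace (poly_op P deriv) M"
  unfolding hypercyclic_subspace_def
  using subspace_M closedin_M not_finitely_spanned hypercyclic_M by blast

end

section \<open>Choice of the parameters\<close>

lemma ex_block_construction:
  assumes "pcompose P [:\<alpha>, 1:] = monom 1 k * R" "k \<ge> 1" "coeff R 0 \<noteq> 0"
  shows "\<exists>m n N \<kappa> q v. block_construction P R \<alpha> k m n N \<kappa> q v"
proof -
  let ?Q = "pcompose P [:\<alpha>, 1:]"
  obtain N\<^sub>0 :: "nat \<Rightarrow> nat" and q\<^sub>0 where q\<^sub>0: "\<And>l p. p > N\<^sub>0 l \<Longrightarrow> q\<^sub>0 l p = (0::complex)"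
      "\<And>b r e. entire_seq b \<Longrightarrow> r \<ge> 0 \<Longrightarrow> e > 0 \<Longrightarrow> \<exists>l. seq_norm r (\<lambda>p. q\<^sub>0 l p - b p) < e"
    using ex_dense_finite_sequences by blast
  \<comment> \<open>The index \<open>i\<close> codes a triple: the exponent index
    \<open>\<kappa> i\<close>, the target index \<open>l i\<close>, and a third number that makes
    every pair of the first two recur for arbitrarily large \<open>i\<close>.\<close>
  define \<kappa> where "\<kappa> i = fst (prod_decode i)" for i
  define l where "l i = fst (prod_decode (snd (prod_decode i)))" for i
  define N where "N i = N\<^sub>0 (l i)" for i
  define q where "q i = q\<^sub>0 (l i)" for i
  \<comment> \<open>The bound \<open>Suc M\<close> gives \<open>m i < k * n i\<close>, since
    \<open>k \<ge> 1\<close>. The radius grows with \<open>i\<close>, which makes the seeds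
    entire.\<close>
  define good where "good i M n v \<longleftrightarrow> n \<ge> Suc M \<and> act (R ^ n) v = q i \<and> (\<forall>p>N i. v p = 0) \<and>
    (\<forall>s. norm (v s) * (2 * (real i + 1)) ^ (k * n + s) / fact (k * n + s) \<le> 1)" for i M n v
  have "\<exists>n v. good i M n v" for i M
    unfolding good_def
    using assms(2,3) by (intro ex_small_preimage) (auto simp: q_def N_def q\<^sub>0(1))
  then obtain \<nu> w where "\<And>i M. good i M (\<nu> i M) (w i M)"
    by metis
  then have \<nu>: "\<And>i M. \<nu> i M \<ge> Suc M" "\<And>i M. act (R ^ \<nu> i M) (w i M) = q i"
      "\<And>i M p. p > N i \<Longrightarrow> w i M p = 0"
      "\<And>i M s. norm (w i M s) * (2 * (real i + 1)) ^ (k * \<nu> i M + s) / fact (k * \<nu> i M + s) \<le> 1"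
    unfolding good_def by blast+
  \<comment> \<open>Large enough both to leave block \<open>i\<close> behind and to absorb the
    constant of \<open>?Q ^ n\<close>.\<close>
  define \<mu> where "\<mu> i n = (SOME t. k * n + N i < t \<and> act_const (?Q ^ n) \<le> 2 ^ t)" for i n
  have "\<exists>t. k * n + N i < t \<and> act_const (?Q ^ n) \<le> 2 ^ t" for i n
  proof -
    obtain c :: nat where c: "act_const (?Q ^ n) < 2 ^ c"
      using real_arch_pow[of 2 "act_const (?Q ^ n)"] by auto
    have "(2::real) ^ c \<le> 2 ^ (c + Suc (k * n + N i))" by (intro power_increasing) auto
    then show ?thesis using c by (intro exI[of _ "c + Suc (k * n + N i)"]) auto
  qed
  from someI_ex[OF this] have \<mu>: "k * n + N i < \<mu> i n \<and> act_const (?Q ^ n) \<le> 2 ^ \<mu> i n" for i n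
    unfolding \<mu>_def .
  \<comment> \<open>From the current exponent \<open>M\<close> first the iterate
    \<open>\<nu> i M\<close> is chosen, then the next exponent beyond its block; no choice refers to
    a later one.\<close>
  define m where "m = rec_nat 0 (\<lambda>i M. \<mu> i (\<nu> i M))"
  have m_Suc: "m (Suc i) = \<mu> i (\<nu> i (m i))" for i by (simp add: m_def)
  have "block_construction P R \<alpha> k m (\<lambda>i. \<nu> i (m i)) N \<kappa> q (\<lambda>i. w i (m i))"
  proof (unfold_locales, unfold m_Suc)
    fix i
    have "m i < \<nu> i (m i)" using \<nu>(1)[of "m i" i] by simp
    also have "\<dots> \<le> k * \<nu> i (m i)" using assms(2) by simp
    finally show "m i < k * \<nu> i (m i)" .
  next
    fix b and r e :: real and I j
    assume "entire_seq b" "0 \<le> r" "0 < e"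
    then obtain l' where l': "seq_norm r (\<lambda>p. q\<^sub>0 l' p - b p) < e" using q\<^sub>0(2) by blast
    \<comment> \<open>A pair code is at least its second component, so nesting \<open>I\<close>
      innermost makes \<open>?i\<close> at least \<open>I\<close>.\<close>
    let ?i = "prod_encode (j, prod_encode (l', I))"
    have "?i \<ge> I" using le_prod_encode_2 order_trans by blast
    then show "\<exists>i\<ge>I. \<kappa> i = j \<and> seq_norm r (\<lambda>p. q i p - b p) < e"
      using l' by (intro exI[of _ ?i]) (simp add: \<kappa>_def q_def l_def)
  qed (use assms(1) \<nu> \<mu> in auto)
  then show ?thesis by blast
qed

theorem corollary5p4:
  fixes P :: "complex poly"
  assumes "degree P > 0"
  shows "\<exists>M. hypercyclic_subspace (poly_op P deriv) M"
proof -
  obtain \<alpha> where \<alpha>: "poly P \<alpha> = 0"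
    using fundamental_theorem_of_algebra[of P] assms by (auto simp: constant_degree)
  let ?Q = "pcompose P [:\<alpha>, 1:]"
  have "?Q \<noteq> 0" using assms by (auto simp: pcompose_eq_0_iff)
  \<comment> \<open>Splitting off the full power of the variable leaves \<open>R\<close> with
    non-zero constant term; the exponent is at least 1 because \<open>?Q\<close> vanishes at 0, the
    translate of the root \<open>\<alpha>\<close>.\<close>
  then obtain R where R: "?Q = [:- 0, 1:] ^ order 0 ?Q * R" "\<not> [:- 0, 1:] dvd R"
    using order_decomp by blast
  have "?Q = monom 1 (order 0 ?Q) * R"
    using R(1) by (simp add: monom_altdef)
  moreover have "order 0 ?Q \<ge> 1"
    using \<alpha> \<open>?Q \<noteq> 0\<close> order_root[of ?Q 0] by (auto simp: poly_pcompose)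
  moreover have "coeff R 0 \<noteq> 0"
    using R(2) by (metis poly_0_coeff_0 poly_eq_0_iff_dvd)
  ultimately show ?thesis
    using ex_block_construction[of P \<alpha>] block_construction.hypercyclic_subspace_M by blast
qed

end
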